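(* Let $\mathbb K$ be a commutative unital ring, $\mathbb B$ an associative unital $\mathbb K$-algebra, $W$ a right $\mathbb B$-module, $\mathcal X$ the set of all $\mathbb B$-submodules of $W$, and $\Gamma:\mathcal X^5\to\mathcal X$, $$\Gamma(x,a,y,b,z)=\{\omega\in W\mid \exists \xi\in x,\alpha\in a,\eta\in y,\beta\in b,\zeta\in z:\ \omega=\zeta+\alpha=\alpha+\eta+\beta=\xi+\beta\}.$$ Define operators of left, middle and right multiplication on $\mathcal X$ by $$L_{xayb}(z):=R_{aybz}(x):=M_{xabz}(y):=\Gamma(x,a,y,b,z).$$ Then, for all $x,a,y,b,z\in\mathcal X$, the pairs $$(L_{xayb},L_{yaxb}),\quad (M_{xabz},M_{zabx}),\quad (R_{aybz},R_{azby})$$ are structural pairs of transformations of $\mathcal X$.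
   Context: A structural (or adjoint) pair of transformations of $\mathcal X$ (i.e. between $\mathcal X$ and itself) is a pair of maps $f,g:\mathcal X\to\mathcal X$ such that for all $x,a,y,b,z,x',a',y',b',z'\in\mathcal X$: $f(\Gamma(x,g(a'),y,g(b'),z))=\Gamma(f(x),a',f(y),b',f(z))$ and $g(\Gamma(x',f(a),y',f(b),z'))=\Gamma(g(x'),a,g(y'),b,g(z'))$. *)

theory Defs
  imports "HOL-Algebra.Module" "HOL-Library.FuncSet"
begin

text \<open>The library locale \<^locale>\<open>algebra\<close> demands a commutative algebra; here the ring \<open>B\<close>
  is only associative and unital, so compatibility is required on both sides.\<close>

locale assoc_algebra = module K B + ring B for K (structure) and B (structure) +
  assumes smult_mult_left:
      "\<lbrakk> k \<in> carrier K; b \<in> carrier B; c \<in> carrier B \<rbrakk> \<Longrightarrow>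
       (k \<odot>\<^bsub>B\<^esub> b) \<otimes>\<^bsub>B\<^esub> c = k \<odot>\<^bsub>B\<^esub> (b \<otimes>\<^bsub>B\<^esub> c)"
    and smult_mult_right:
      "\<lbrakk> k \<in> carrier K; b \<in> carrier B; c \<in> carrier B \<rbrakk> \<Longrightarrow>
       b \<otimes>\<^bsub>B\<^esub> (k \<odot>\<^bsub>B\<^esub> c) = k \<odot>\<^bsub>B\<^esub> (b \<otimes>\<^bsub>B\<^esub> c)"

text \<open>Right modules reuse the record of left modules: \<open>b \<odot>\<^bsub>W\<^esub> w\<close> stands for the right action
  \<open>w \<cdot> b\<close>, whence the reversed order in \<open>ract_mult\<close>.  The library locale \<^locale>\<open>module\<close> is
  not applicable since its ring of scalars is commutative.\<close>

locale right_module = B?: ring B + W?: abelian_group W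
  for B (structure) and W (structure) +
  assumes ract_closed:
      "\<lbrakk> b \<in> carrier B; w \<in> carrier W \<rbrakk> \<Longrightarrow> b \<odot>\<^bsub>W\<^esub> w \<in> carrier W"
    and ract_add_scalar:
      "\<lbrakk> b \<in> carrier B; c \<in> carrier B; w \<in> carrier W \<rbrakk> \<Longrightarrow>
       (b \<oplus>\<^bsub>B\<^esub> c) \<odot>\<^bsub>W\<^esub> w = b \<odot>\<^bsub>W\<^esub> w \<oplus>\<^bsub>W\<^esub> c \<odot>\<^bsub>W\<^esub> w"
    and ract_add_vector:
      "\<lbrakk> b \<in> carrier B; v \<in> carrier W; w \<in> carrier W \<rbrakk> \<Longrightarrow>
       b \<odot>\<^bsub>W\<^esub> (v \<oplus>\<^bsub>W\<^esub> w) = b \<odot>\<^bsub>W\<^esub> v \<oplus>\<^bsub>W\<^esub> b \<odot>\<^bsub>W\<^esub> w"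
    and ract_mult:
      "\<lbrakk> b \<in> carrier B; c \<in> carrier B; w \<in> carrier W \<rbrakk> \<Longrightarrow>
       (b \<otimes>\<^bsub>B\<^esub> c) \<odot>\<^bsub>W\<^esub> w = c \<odot>\<^bsub>W\<^esub> (b \<odot>\<^bsub>W\<^esub> w)"
    and ract_one:
      "w \<in> carrier W \<Longrightarrow> \<one>\<^bsub>B\<^esub> \<odot>\<^bsub>W\<^esub> w = w"

text \<open>The library predicate \<^locale>\<open>submodule\<close> (additive subgroup closed under \<open>\<odot>\<close>) does not
  presuppose commutative scalars.\<close>

definition submodules :: "('b, 'm) ring_scheme \<Rightarrow> ('b, 'w, 'n) module_scheme \<Rightarrow> 'w set set"
  where "submodules B W = {x. submodule x B W}"

definition Gam :: "('w, 'n) ring_scheme \<Rightarrow> 'w set \<Rightarrow> 'w set \<Rightarrow> 'w set \<Rightarrow> 'w set \<Rightarrow> 'w set \<Rightarrow> 'w set"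
  where "Gam W x a y b z =
    {\<omega> \<in> carrier W. \<exists>\<xi>\<in>x. \<exists>\<alpha>\<in>a. \<exists>\<eta>\<in>y. \<exists>\<beta>\<in>b. \<exists>\<zeta>\<in>z.
       \<omega> = \<zeta> \<oplus>\<^bsub>W\<^esub> \<alpha> \<and> \<omega> = \<alpha> \<oplus>\<^bsub>W\<^esub> \<eta> \<oplus>\<^bsub>W\<^esub> \<beta> \<and> \<omega> = \<xi> \<oplus>\<^bsub>W\<^esub> \<beta>}"

text \<open>The arguments of each operator come in the order of its subscripts, followed by the
  variable the operator acts on.\<close>

definition Lop :: "('w, 'n) ring_scheme \<Rightarrow> 'w set \<Rightarrow> 'w set \<Rightarrow> 'w set \<Rightarrow> 'w set \<Rightarrow> 'w set \<Rightarrow> 'w set"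
  where "Lop W x a y b z = Gam W x a y b z"

definition Mop :: "('w, 'n) ring_scheme \<Rightarrow> 'w set \<Rightarrow> 'w set \<Rightarrow> 'w set \<Rightarrow> 'w set \<Rightarrow> 'w set \<Rightarrow> 'w set"
  where "Mop W x a b z y = Gam W x a y b z"

definition Rop :: "('w, 'n) ring_scheme \<Rightarrow> 'w set \<Rightarrow> 'w set \<Rightarrow> 'w set \<Rightarrow> 'w set \<Rightarrow> 'w set \<Rightarrow> 'w set"
  where "Rop W a y b z x = Gam W x a y b z"

definition structural_pair ::
    "'p set \<Rightarrow> ('p \<Rightarrow> 'p \<Rightarrow> 'p \<Rightarrow> 'p \<Rightarrow> 'p \<Rightarrow> 'p) \<Rightarrow> ('p \<Rightarrow> 'p) \<Rightarrow> ('p \<Rightarrow> 'p) \<Rightarrow> bool"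
  where "structural_pair X G f g \<longleftrightarrow>
    f \<in> X \<rightarrow> X \<and> g \<in> X \<rightarrow> X \<and>
    (\<forall>x\<in>X. \<forall>a\<in>X. \<forall>y\<in>X. \<forall>b\<in>X. \<forall>z\<in>X. \<forall>x'\<in>X. \<forall>a'\<in>X. \<forall>y'\<in>X. \<forall>b'\<in>X. \<forall>z'\<in>X.
       f (G x (g a') y (g b') z) = G (f x) a' (f y) b' (f z) \<and>
       g (G x' (f a) y' (f b) z') = G (g x') a (g y') b (g z'))"

end

theory Submission
  imports Defs "HOL-Algebra.AbelCoset"
begin

text \<open>Each of the operators \<open>L\<close>, \<open>M\<close>, \<open>R\<close> is \<open>Z \<mapsto> r `` Z\<close> for a relation \<open>r\<close> that is an
  additive subgroup of \<open>W \<times> W\<close>, and the partner in its pair is the operator of the converse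
  relation. For every additive relation the image map is structural with respect to the preimage
  map: images of \<open>\<eta>\<close>, \<open>\<eta> + \<beta>\<close> and \<open>\<alpha> + \<eta>\<close> determine one of \<open>\<alpha> + \<eta> + \<beta>\<close> by addition and subtraction,
  and conversely images of \<open>\<alpha>\<close>, \<open>\<beta>\<close> and \<open>\<alpha> + \<eta> + \<beta>\<close> determine one of \<open>\<eta>\<close>.\<close>

section \<open>Additive relations and the relations of left and middle multiplication\<close>

definition additive_relation :: "('w, 'n) ring_scheme \<Rightarrow> ('w \<times> 'w) set \<Rightarrow> bool"
  where "additive_relation W r \<longleftrightarrow> r \<subseteq> carrier W \<times> carrier W \<and>
    (\<forall>p q p' q'. (p, q) \<in> r \<longrightarrow> (p', q') \<in> r \<longrightarrow>
      (p \<oplus>\<^bsub>W\<^esub> p', q \<oplus>\<^bsub>W\<^esub> q') \<in> r \<and> (p \<ominus>\<^bsub>W\<^esub> p', q \<ominus>\<^bsub>W\<^esub> q') \<in> r)"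

text \<open>The pairs are \<open>(\<zeta>, \<omega>)\<close> from the definition of
  \<open>Gam\<close>, with \<zeta> and \<xi> expressed through \<alpha>, \<eta>, \<beta>. The
  condition that \<zeta> lies in \<open>z\<close> is left to the image operation.\<close>

definition left_relation :: "('w, 'n) ring_scheme \<Rightarrow> 'w set \<Rightarrow> 'w set \<Rightarrow> 'w set \<Rightarrow> 'w set \<Rightarrow> ('w \<times> 'w) set"
  where "left_relation W x a y b =
    {(\<eta> \<oplus>\<^bsub>W\<^esub> \<beta>, \<alpha> \<oplus>\<^bsub>W\<^esub> \<eta> \<oplus>\<^bsub>W\<^esub> \<beta>) | \<alpha> \<eta> \<beta>. \<alpha> \<in> a \<and> \<eta> \<in> y \<and> \<beta> \<in> b \<and> \<alpha> \<oplus>\<^bsub>W\<^esub> \<eta> \<in> x}"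

text \<open>Here \<eta> itself is the input, so it ranges over the whole carrier, while the
  conditions on both \<xi> = \<alpha> + \<eta> and \<zeta> = \<eta> + \<beta> stay in the
  relation.\<close>

definition middle_relation :: "('w, 'n) ring_scheme \<Rightarrow> 'w set \<Rightarrow> 'w set \<Rightarrow> 'w set \<Rightarrow> 'w set \<Rightarrow> ('w \<times> 'w) set"
  where "middle_relation W x a b z =
    {(\<eta>, \<alpha> \<oplus>\<^bsub>W\<^esub> \<eta> \<oplus>\<^bsub>W\<^esub> \<beta>) | \<alpha> \<eta> \<beta>. \<alpha> \<in> a \<and> \<eta> \<in> carrier W \<and> \<beta> \<in> b \<and>
       \<alpha> \<oplus>\<^bsub>W\<^esub> \<eta> \<in> x \<and> \<eta> \<oplus>\<^bsub>W\<^esub> \<beta> \<in> z}"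

text \<open>Giving the components by equations lets the rule apply to pairs that equal the required
  sums only after regrouping.\<close>

lemma left_relationI:
  assumes "\<alpha> \<in> a" "\<eta> \<in> y" "\<beta> \<in> b" "\<alpha> \<oplus>\<^bsub>W\<^esub> \<eta> \<in> x"
    and "p = \<eta> \<oplus>\<^bsub>W\<^esub> \<beta>" "q = \<alpha> \<oplus>\<^bsub>W\<^esub> \<eta> \<oplus>\<^bsub>W\<^esub> \<beta>"
  shows "(p, q) \<in> left_relation W x a y b"
  using assms unfolding left_relation_def by blast

lemma middle_relationI:
  assumes "\<alpha> \<in> a" "p \<in> carrier W" "\<beta> \<in> b" "\<alpha> \<oplus>\<^bsub>W\<^esub> p \<in> x" "p \<oplus>\<^bsub>W\<^esub> \<beta> \<in> z"
    and "q = \<alpha> \<oplus>\<^bsub>W\<^esub> p \<oplus>\<^bsub>W\<^esub> \<beta>"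
  shows "(p, q) \<in> middle_relation W x a b z"
  using assms unfolding middle_relation_def by blast

lemma additive_relation_converse:
  "additive_relation W r \<Longrightarrow> additive_relation W (r\<inverse>)"
  by (auto simp: additive_relation_def)

section \<open>Gamma on subsets of an abelian group, and images under additive relations\<close>

context abelian_group
begin

lemma additive_subgroup_minus_closed:
  assumes "additive_subgroup H G" "h \<in> H" "k \<in> H"
  shows "h \<ominus> k \<in> H"
  using assms
  by (simp add: a_minus_def additive_subgroup.a_closed additive_subgroup.a_inv_closed)

lemma add_diff_cancel_right:
  assumes "g \<in> carrier G" "h \<in> carrier G"
  shows "g \<oplus> h \<ominus> h = g"
  using assms by (simp add: a_minus_def a_assoc r_neg)

lemma diff_add_cancel:
  assumes "g \<in> carrier G" "h \<in> carrier G"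
  shows "g \<ominus> h \<oplus> h = g"
  using assms by (simp add: a_minus_def a_assoc l_neg)

text \<open>Cancelling \<beta> in \<alpha> + \<eta> + \<beta> = \<xi> + \<beta> forces \<xi> =
  \<alpha> + \<eta>, and cancelling \<alpha> forces \<zeta> = \<eta> + \<beta>. Three parameters
  remain, with conditions on the two partial sums.\<close>

lemma Gam_eq:
  assumes "x \<subseteq> carrier G" "a \<subseteq> carrier G" "y \<subseteq> carrier G" "b \<subseteq> carrier G" "z \<subseteq> carrier G"
  shows "Gam G x a y b z =
    {\<alpha> \<oplus> \<eta> \<oplus> \<beta> | \<alpha> \<eta> \<beta>. \<alpha> \<in> a \<and> \<eta> \<in> y \<and> \<beta> \<in> b \<and> \<alpha> \<oplus> \<eta> \<in> x \<and> \<eta> \<oplus> \<beta> \<in> z}" (is "_ = ?R")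
proof (intro equalityI subsetI)
  fix \<omega> assume "\<omega> \<in> Gam G x a y b z"
  then obtain \<xi> \<alpha> \<eta> \<beta> \<zeta> where mem: "\<xi> \<in> x" "\<alpha> \<in> a" "\<eta> \<in> y" "\<beta> \<in> b" "\<zeta> \<in> z"
    and eq: "\<omega> = \<zeta> \<oplus> \<alpha>" "\<omega> = \<alpha> \<oplus> \<eta> \<oplus> \<beta>" "\<omega> = \<xi> \<oplus> \<beta>"
    unfolding Gam_def by blast
  have c: "\<xi> \<in> carrier G" "\<alpha> \<in> carrier G" "\<eta> \<in> carrier G" "\<beta> \<in> carrier G" "\<zeta> \<in> carrier G"
    using mem assms by auto
  have "\<alpha> \<oplus> \<eta> = \<xi>"
    using eq(2,3) c by simp
  moreover have "\<alpha> \<oplus> (\<eta> \<oplus> \<beta>) = \<alpha> \<oplus> \<zeta>"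
    using eq(1,2) c by (simp add: a_ac)
  then have "\<eta> \<oplus> \<beta> = \<zeta>"
    using c by simp
  ultimately show "\<omega> \<in> ?R"
    using mem eq(2) by blast
next
  fix \<omega> assume "\<omega> \<in> ?R"
  then obtain \<alpha> \<eta> \<beta> where mem: "\<alpha> \<in> a" "\<eta> \<in> y" "\<beta> \<in> b" "\<alpha> \<oplus> \<eta> \<in> x" "\<eta> \<oplus> \<beta> \<in> z"
    and eq: "\<omega> = \<alpha> \<oplus> \<eta> \<oplus> \<beta>"
    by blast
  have c: "\<alpha> \<in> carrier G" "\<eta> \<in> carrier G" "\<beta> \<in> carrier G"
    using mem assms by auto
  have "\<omega> \<in> carrier G" "\<omega> = (\<eta> \<oplus> \<beta>) \<oplus> \<alpha>"
    using eq c by (simp_all add: a_ac)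
  then show "\<omega> \<in> Gam G x a y b z"
    unfolding Gam_def using mem eq by blast
qed

text \<open>By commutativity the triple (\<alpha>, \<eta>, \<beta>) can be read backwards, which
  exchanges the two partial sums. This reduces right multiplication to left multiplication.\<close>

lemma Gam_reverse:
  assumes "x \<subseteq> carrier G" "a \<subseteq> carrier G" "y \<subseteq> carrier G" "b \<subseteq> carrier G" "z \<subseteq> carrier G"
  shows "Gam G x a y b z = Gam G z b y a x"
proof -
  have "Gam G x a y b z \<subseteq> Gam G z b y a x"
    if s: "x \<subseteq> carrier G" "a \<subseteq> carrier G" "y \<subseteq> carrier G" "b \<subseteq> carrier G" "z \<subseteq> carrier G"
    for x a y b z
  proof
    fix \<omega> assume "\<omega> \<in> Gam G x a y b z"
    then obtain \<alpha> \<eta> \<beta> where mem: "\<alpha> \<in> a" "\<eta> \<in> y" "\<beta> \<in> b" "\<alpha> \<oplus> \<eta> \<in> x" "\<eta> \<oplus> \<beta> \<in> z"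
      and eq: "\<omega> = \<alpha> \<oplus> \<eta> \<oplus> \<beta>"
      unfolding Gam_eq[OF s] by blast
    have c: "\<alpha> \<in> carrier G" "\<eta> \<in> carrier G" "\<beta> \<in> carrier G"
      using mem s by auto
    have "\<omega> = \<beta> \<oplus> \<eta> \<oplus> \<alpha>" "\<beta> \<oplus> \<eta> \<in> z" "\<eta> \<oplus> \<alpha> \<in> x"
      using mem eq c by (simp_all add: a_ac)
    then show "\<omega> \<in> Gam G z b y a x"
      unfolding Gam_eq[OF s(5,4,3,2,1)] using mem by blast
  qed
  from this[OF assms] this[OF assms(5,4,3,2,1)] show ?thesis
    by blast
qed

lemma additive_relation_Image_Gam:
  assumes r: "additive_relation G r"
    and s: "X \<subseteq> carrier G" "A \<subseteq> carrier G" "Y \<subseteq> carrier G" "B \<subseteq> carrier G" "Z \<subseteq> carrier G"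
  shows "r `` Gam G X (r\<inverse> `` A) Y (r\<inverse> `` B) Z = Gam G (r `` X) A (r `` Y) B (r `` Z)"
proof -
  have car: "p \<in> carrier G" "q \<in> carrier G" if "(p, q) \<in> r" for p q
    using r that by (auto simp: additive_relation_def)
  have add: "(p \<oplus> p', q \<oplus> q') \<in> r" and diff: "(p \<ominus> p', q \<ominus> q') \<in> r"
    if "(p, q) \<in> r" "(p', q') \<in> r" for p q p' q'
    using r that by (auto simp: additive_relation_def)
  have ri: "r `` S \<subseteq> carrier G" "r\<inverse> `` S \<subseteq> carrier G" for S
    using car by auto
  note lhs = Gam_eq[OF s(1) ri(2)[of A] s(3) ri(2)[of B] s(5)]
  note rhs = Gam_eq[OF ri(1)[of X] s(2) ri(1)[of Y] s(4) ri(1)[of Z]]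
  show ?thesis
  proof (intro equalityI subsetI)
    fix \<omega>' assume "\<omega>' \<in> r `` Gam G X (r\<inverse> `` A) Y (r\<inverse> `` B) Z"
    then obtain \<alpha> \<eta> \<beta> \<alpha>' \<beta>' where mem: "\<eta> \<in> Y" "\<alpha> \<oplus> \<eta> \<in> X" "\<eta> \<oplus> \<beta> \<in> Z" "\<alpha>' \<in> A" "\<beta>' \<in> B"
      and rel: "(\<alpha>, \<alpha>') \<in> r" "(\<beta>, \<beta>') \<in> r" "(\<alpha> \<oplus> \<eta> \<oplus> \<beta>, \<omega>') \<in> r"
      unfolding lhs by blast
    \<comment> \<open>The only value compatible with \<omega>' = \<alpha>' + \<eta>' +
      \<beta>'.\<close>
    define \<eta>' where "\<eta>' = \<omega>' \<ominus> \<beta>' \<ominus> \<alpha>'"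
    have c: "\<alpha> \<in> carrier G" "\<beta> \<in> carrier G" "\<eta> \<in> carrier G"
      "\<alpha>' \<in> carrier G" "\<beta>' \<in> carrier G" "\<omega>' \<in> carrier G"
      using car rel mem(1) s(3) by auto
    \<comment> \<open>Subtracting the pairs of \<beta> and \<alpha> from the pair of the total thus
      leaves a pair with first component \<eta>.\<close>
    have "\<alpha> \<oplus> \<eta> \<oplus> \<beta> \<ominus> \<beta> \<ominus> \<alpha> = \<eta>"
      using c by (simp add: add_diff_cancel_right a_comm[of \<alpha> \<eta>])
    then have "(\<eta>, \<eta>') \<in> r"
      using diff[OF diff[OF rel(3,2)] rel(1)] by (simp add: \<eta>'_def)
    moreover from this have "(\<alpha> \<oplus> \<eta>, \<alpha>' \<oplus> \<eta>') \<in> r" "(\<eta> \<oplus> \<beta>, \<eta>' \<oplus> \<beta>') \<in> r"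
      using add rel by auto
    moreover have "\<omega>' = \<alpha>' \<oplus> \<eta>' \<oplus> \<beta>'"
      unfolding \<eta>'_def using c
      by (simp add: diff_add_cancel a_comm[of \<alpha>' "\<omega>' \<ominus> \<beta>' \<ominus> \<alpha>'"])
    ultimately show "\<omega>' \<in> Gam G (r `` X) A (r `` Y) B (r `` Z)"
      unfolding rhs using mem by blast
  next
    fix \<omega>' assume "\<omega>' \<in> Gam G (r `` X) A (r `` Y) B (r `` Z)"
    then obtain \<alpha>' \<eta>' \<beta>' \<xi> \<eta> \<zeta> where mem: "\<alpha>' \<in> A" "\<beta>' \<in> B" "\<xi> \<in> X" "\<eta> \<in> Y" "\<zeta> \<in> Z"
      and rel: "(\<xi>, \<alpha>' \<oplus> \<eta>') \<in> r" "(\<eta>, \<eta>') \<in> r" "(\<zeta>, \<eta>' \<oplus> \<beta>') \<in> r"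
      and eq: "\<omega>' = \<alpha>' \<oplus> \<eta>' \<oplus> \<beta>'"
      unfolding rhs by blast
    have c: "\<xi> \<in> carrier G" "\<eta> \<in> carrier G" "\<zeta> \<in> carrier G"
      "\<alpha>' \<in> carrier G" "\<beta>' \<in> carrier G" "\<eta>' \<in> carrier G"
      using car rel mem s by auto
    have "\<alpha>' \<oplus> \<eta>' \<ominus> \<eta>' = \<alpha>'" "\<eta>' \<oplus> \<beta>' \<ominus> \<eta>' = \<beta>'"
      using c by (simp_all add: add_diff_cancel_right a_comm[of \<eta>' \<beta>'])
    \<comment> \<open>Preimages of \<alpha>' and \<beta>' are not given; they arise by subtracting
      the pair of \<eta>' from those of the two partial sums.\<close>
    then have "(\<xi> \<ominus> \<eta>, \<alpha>') \<in> r" "(\<zeta> \<ominus> \<eta>, \<beta>') \<in> r"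
      using diff[OF rel(1,2)] diff[OF rel(3,2)] by simp_all
    \<comment> \<open>The preimage of \<omega>' is built from the parameters \<xi> - \<eta>, \<eta>,
      \<zeta> - \<eta>, whose partial sums collapse to \<xi> in \<open>X\<close> and \<zeta> in
      \<open>Z\<close>.\<close>
    moreover have "(\<xi> \<ominus> \<eta> \<oplus> \<eta> \<oplus> (\<zeta> \<ominus> \<eta>), \<omega>') \<in> r"
      unfolding eq using add calculation rel(2) by blast
    moreover have "\<xi> \<ominus> \<eta> \<oplus> \<eta> = \<xi>" "\<eta> \<oplus> (\<zeta> \<ominus> \<eta>) = \<zeta>"
      using c by (simp_all add: diff_add_cancel a_comm[of \<eta> "\<zeta> \<ominus> \<eta>"])
    then have "\<xi> \<ominus> \<eta> \<oplus> \<eta> \<in> X" "\<eta> \<oplus> (\<zeta> \<ominus> \<eta>) \<in> Z"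
      using mem by simp_all
    ultimately show "\<omega>' \<in> r `` Gam G X (r\<inverse> `` A) Y (r\<inverse> `` B) Z"
      unfolding lhs using mem by blast
  qed
qed

text \<open>The first identity is \<open>additive_relation_Image_Gam\<close> for \<open>r\<close>;
  the second is the same lemma for the converse of \<open>r\<close>, whose converse is
  \<open>r\<close> again.\<close>

lemma structural_pair_Image:
  assumes r: "additive_relation G r" and sub: "\<And>S. S \<in> \<X> \<Longrightarrow> S \<subseteq> carrier G"
    and f: "\<And>S. S \<in> \<X> \<Longrightarrow> f S = r `` S" "f \<in> \<X> \<rightarrow> \<X>"
    and g: "\<And>S. S \<in> \<X> \<Longrightarrow> g S = r\<inverse> `` S" "g \<in> \<X> \<rightarrow> \<X>"
    and Gam: "\<And>x a y b z. \<lbrakk> x \<in> \<X>; a \<in> \<X>; y \<in> \<X>; b \<in> \<X>; z \<in> \<X> \<rbrakk> \<Longrightarrow> Gam G x a y b z \<in> \<X>"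
  shows "structural_pair \<X> (Gam G) f g"
proof -
  note fX = funcset_mem[OF f(2)] and gX = funcset_mem[OF g(2)]
  have "f (Gam G x (g a') y (g b') z) = Gam G (f x) a' (f y) b' (f z)"
    if "x \<in> \<X>" "a' \<in> \<X>" "y \<in> \<X>" "b' \<in> \<X>" "z \<in> \<X>" for x a' y b' z
    \<comment> \<open>\<open>f\<close> is unfolded before \<open>g\<close>: its rule needs the
      argument to lie in \<X>, which is visible as long as \<open>g a'\<close> and
      \<open>g b'\<close> are not yet replaced by preimages.\<close>
    using additive_relation_Image_Gam[OF r, of x a' y b' z] that
    by (simp add: f(1) Gam gX sub) (simp add: g(1))
  moreover have "g (Gam G x (f a) y (f b) z) = Gam G (g x) a (g y) b (g z)"
    if "x \<in> \<X>" "a \<in> \<X>" "y \<in> \<X>" "b \<in> \<X>" "z \<in> \<X>" for x a y b z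
    using additive_relation_Image_Gam[OF additive_relation_converse[OF r], of x a y b z] that
    by (simp add: g(1) Gam fX sub) (simp add: f(1))
  ultimately show ?thesis
    using f(2) g(2) by (simp add: structural_pair_def)
qed

section \<open>Left and middle multiplication as images under additive relations\<close>

lemma Gam_eq_left_relation_Image:
  assumes "x \<subseteq> carrier G" "a \<subseteq> carrier G" "y \<subseteq> carrier G" "b \<subseteq> carrier G" "z \<subseteq> carrier G"
  shows "Gam G x a y b z = left_relation G x a y b `` z"
  unfolding Gam_eq[OF assms] left_relation_def by blast

lemma Gam_eq_middle_relation_Image:
  assumes "x \<subseteq> carrier G" "a \<subseteq> carrier G" "y \<subseteq> carrier G" "b \<subseteq> carrier G" "z \<subseteq> carrier G"
  shows "Gam G x a y b z = middle_relation G x a b z `` y"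
  unfolding Gam_eq[OF assms] middle_relation_def using assms(3) by blast

text \<open>A pair with parameters (\<alpha>, \<eta>, \<beta>) is reversed by the parameters
  (-\<alpha>, \<alpha> + \<eta>, \<beta>). The new middle parameter lies in \<open>x\<close>, and
  the new first partial sum is \<eta> in \<open>y\<close>, so \<open>x\<close> and \<open>y\<close>
  change places.\<close>

lemma left_relation_converse:
  assumes sub: "additive_subgroup x G" "additive_subgroup a G"
    "additive_subgroup y G" "additive_subgroup b G"
  shows "(left_relation G x a y b)\<inverse> = left_relation G y a x b"
proof -
  have "(q, p) \<in> left_relation G y a x b"
    if s: "additive_subgroup x G" "additive_subgroup a G"
      "additive_subgroup y G" "additive_subgroup b G"
      and pq: "(p, q) \<in> left_relation G x a y b" for x y p q
  proof -
    obtain \<alpha> \<eta> \<beta> where mem: "\<alpha> \<in> a" "\<eta> \<in> y" "\<beta> \<in> b" "\<alpha> \<oplus> \<eta> \<in> x"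
      and eq: "p = \<eta> \<oplus> \<beta>" "q = \<alpha> \<oplus> \<eta> \<oplus> \<beta>"
      using pq unfolding left_relation_def by blast
    have c: "\<alpha> \<in> carrier G" "\<eta> \<in> carrier G" "\<beta> \<in> carrier G"
      using mem s[THEN additive_subgroup.a_subset] by auto
    have "\<ominus> \<alpha> \<in> a"
      using mem s by (simp add: additive_subgroup.a_inv_closed)
    moreover have "\<ominus> \<alpha> \<oplus> (\<alpha> \<oplus> \<eta>) = \<eta>"
      using c by (simp add: r_neg1)
    ultimately show ?thesis
      using mem eq by (intro left_relationI[of "\<ominus> \<alpha>" _ "\<alpha> \<oplus> \<eta>" _ \<beta>]) simp_all
  qed
  \<comment> \<open>The inclusion was shown for arbitrary \<open>x\<close> and \<open>y\<close>;
    exchanging them yields the opposite one.\<close>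
  from this[OF sub] this[OF sub(3,2,1,4)] show ?thesis
    by (intro equalityI subrelI) auto
qed

text \<open>Solving q = \<alpha> + p + \<beta> for p gives the outer parameters -\<alpha> and
  -\<beta>. The partial sums become -\<alpha> + q = p + \<beta> in \<open>z\<close> and q - \<beta>
  = \<alpha> + p in \<open>x\<close>, so these two change places.\<close>

lemma middle_relation_converse:
  assumes sub: "additive_subgroup x G" "additive_subgroup a G"
    "additive_subgroup b G" "additive_subgroup z G"
  shows "(middle_relation G x a b z)\<inverse> = middle_relation G z a b x"
proof -
  have "(q, p) \<in> middle_relation G z a b x"
    if s: "additive_subgroup x G" "additive_subgroup a G"
      "additive_subgroup b G" "additive_subgroup z G"
      and pq: "(p, q) \<in> middle_relation G x a b z" for x z p q
  proof -
    obtain \<alpha> \<beta> where mem: "\<alpha> \<in> a" "p \<in> carrier G" "\<beta> \<in> b" "\<alpha> \<oplus> p \<in> x" "p \<oplus> \<beta> \<in> z"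
      and eq: "q = \<alpha> \<oplus> p \<oplus> \<beta>"
      using pq unfolding middle_relation_def by blast
    have c: "\<alpha> \<in> carrier G" "\<beta> \<in> carrier G"
      using mem s[THEN additive_subgroup.a_subset] by auto
    have inv: "\<ominus> \<alpha> \<in> a" "\<ominus> \<beta> \<in> b"
      using mem s by (simp_all add: additive_subgroup.a_inv_closed)
    have "q \<in> carrier G"
      using eq c mem by simp
    moreover have "\<ominus> \<alpha> \<oplus> q = p \<oplus> \<beta>" "q \<oplus> \<ominus> \<beta> = \<alpha> \<oplus> p" "p = \<ominus> \<alpha> \<oplus> q \<oplus> \<ominus> \<beta>"
      unfolding eq using c mem(2) by (simp_all add: a_assoc r_neg r_neg1)
    ultimately show ?thesis
      using inv mem by (intro middle_relationI[of "\<ominus> \<alpha>" _ _ _ "\<ominus> \<beta>"]) simp_all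
  qed
  from this[OF sub] this[OF sub(4,2,3,1)] show ?thesis
    by (intro equalityI subrelI) auto
qed

text \<open>The admissible triples (\<alpha>, \<eta>, \<beta>) form a subgroup of the threefold
  product, and the relation is its image under a homomorphism. Sums and differences of pairs are
  therefore represented by those of the parameters.\<close>

lemma additive_relation_left_relation:
  assumes s: "additive_subgroup x G" "additive_subgroup a G"
    "additive_subgroup y G" "additive_subgroup b G"
  shows "additive_relation G (left_relation G x a y b)"
  unfolding additive_relation_def
proof (intro conjI allI impI)
  show "left_relation G x a y b \<subseteq> carrier G \<times> carrier G"
    using s[THEN additive_subgroup.a_subset] by (auto simp: left_relation_def)
next
  fix p q p' q'
  assume "(p, q) \<in> left_relation G x a y b" "(p', q') \<in> left_relation G x a y b"
  then obtain \<alpha> \<eta> \<beta> \<alpha>' \<eta>' \<beta>'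
    where mem: "\<alpha> \<in> a" "\<eta> \<in> y" "\<beta> \<in> b" "\<alpha> \<oplus> \<eta> \<in> x" "\<alpha>' \<in> a" "\<eta>' \<in> y" "\<beta>' \<in> b" "\<alpha>' \<oplus> \<eta>' \<in> x"
      and eq: "p = \<eta> \<oplus> \<beta>" "q = \<alpha> \<oplus> \<eta> \<oplus> \<beta>" "p' = \<eta>' \<oplus> \<beta>'" "q' = \<alpha>' \<oplus> \<eta>' \<oplus> \<beta>'"
    unfolding left_relation_def by blast
  have c: "\<alpha> \<in> carrier G" "\<eta> \<in> carrier G" "\<beta> \<in> carrier G"
    "\<alpha>' \<in> carrier G" "\<eta>' \<in> carrier G" "\<beta>' \<in> carrier G"
    using mem s[THEN additive_subgroup.a_subset] by auto
  have "p \<oplus> p' = (\<eta> \<oplus> \<eta>') \<oplus> (\<beta> \<oplus> \<beta>')" "q \<oplus> q' = (\<alpha> \<oplus> \<alpha>') \<oplus> (\<eta> \<oplus> \<eta>') \<oplus> (\<beta> \<oplus> \<beta>')"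
    "(\<alpha> \<oplus> \<alpha>') \<oplus> (\<eta> \<oplus> \<eta>') = (\<alpha> \<oplus> \<eta>) \<oplus> (\<alpha>' \<oplus> \<eta>')"
    unfolding eq using c by (simp_all add: a_minus_def minus_add a_ac)
  moreover have "\<alpha> \<oplus> \<alpha>' \<in> a" "\<eta> \<oplus> \<eta>' \<in> y" "\<beta> \<oplus> \<beta>' \<in> b" "(\<alpha> \<oplus> \<eta>) \<oplus> (\<alpha>' \<oplus> \<eta>') \<in> x"
    using mem s by (simp_all add: additive_subgroup.a_closed)
  ultimately show "(p \<oplus> p', q \<oplus> q') \<in> left_relation G x a y b"
    by (intro left_relationI[of "\<alpha> \<oplus> \<alpha>'" _ "\<eta> \<oplus> \<eta>'" _ "\<beta> \<oplus> \<beta>'"]) simp_all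
  have "p \<ominus> p' = (\<eta> \<ominus> \<eta>') \<oplus> (\<beta> \<ominus> \<beta>')" "q \<ominus> q' = (\<alpha> \<ominus> \<alpha>') \<oplus> (\<eta> \<ominus> \<eta>') \<oplus> (\<beta> \<ominus> \<beta>')"
    "(\<alpha> \<ominus> \<alpha>') \<oplus> (\<eta> \<ominus> \<eta>') = (\<alpha> \<oplus> \<eta>) \<ominus> (\<alpha>' \<oplus> \<eta>')"
    unfolding eq using c by (simp_all add: a_minus_def minus_add a_ac)
  moreover have "\<alpha> \<ominus> \<alpha>' \<in> a" "\<eta> \<ominus> \<eta>' \<in> y" "\<beta> \<ominus> \<beta>' \<in> b" "(\<alpha> \<oplus> \<eta>) \<ominus> (\<alpha>' \<oplus> \<eta>') \<in> x"
    using mem s by (simp_all add: additive_subgroup_minus_closed)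
  ultimately show "(p \<ominus> p', q \<ominus> q') \<in> left_relation G x a y b"
    by (intro left_relationI[of "\<alpha> \<ominus> \<alpha>'" _ "\<eta> \<ominus> \<eta>'" _ "\<beta> \<ominus> \<beta>'"]) simp_all
qed

text \<open>As for left multiplication, the parameters are added or subtracted componentwise; now
  both partial sums have to be regrouped.\<close>

lemma additive_relation_middle_relation:
  assumes s: "additive_subgroup x G" "additive_subgroup a G"
    "additive_subgroup b G" "additive_subgroup z G"
  shows "additive_relation G (middle_relation G x a b z)"
  unfolding additive_relation_def
proof (intro conjI allI impI)
  show "middle_relation G x a b z \<subseteq> carrier G \<times> carrier G"
    using s[THEN additive_subgroup.a_subset] by (auto simp: middle_relation_def)
next
  fix p q p' q'
  assume "(p, q) \<in> middle_relation G x a b z" "(p', q') \<in> middle_relation G x a b z"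
  then obtain \<alpha> \<beta> \<alpha>' \<beta>'
    where mem: "\<alpha> \<in> a" "\<beta> \<in> b" "\<alpha> \<oplus> p \<in> x" "p \<oplus> \<beta> \<in> z"
      "\<alpha>' \<in> a" "\<beta>' \<in> b" "\<alpha>' \<oplus> p' \<in> x" "p' \<oplus> \<beta>' \<in> z"
      and p: "p \<in> carrier G" "p' \<in> carrier G"
      and eq: "q = \<alpha> \<oplus> p \<oplus> \<beta>" "q' = \<alpha>' \<oplus> p' \<oplus> \<beta>'"
    unfolding middle_relation_def by blast
  have c: "\<alpha> \<in> carrier G" "\<beta> \<in> carrier G" "\<alpha>' \<in> carrier G" "\<beta>' \<in> carrier G"
    using mem s[THEN additive_subgroup.a_subset] by auto
  have "q \<oplus> q' = (\<alpha> \<oplus> \<alpha>') \<oplus> (p \<oplus> p') \<oplus> (\<beta> \<oplus> \<beta>')"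
    "(\<alpha> \<oplus> \<alpha>') \<oplus> (p \<oplus> p') = (\<alpha> \<oplus> p) \<oplus> (\<alpha>' \<oplus> p')"
    "(p \<oplus> p') \<oplus> (\<beta> \<oplus> \<beta>') = (p \<oplus> \<beta>) \<oplus> (p' \<oplus> \<beta>')"
    unfolding eq using c p by (simp_all add: a_minus_def minus_add a_ac)
  moreover have "\<alpha> \<oplus> \<alpha>' \<in> a" "\<beta> \<oplus> \<beta>' \<in> b" "(\<alpha> \<oplus> p) \<oplus> (\<alpha>' \<oplus> p') \<in> x"
    "(p \<oplus> \<beta>) \<oplus> (p' \<oplus> \<beta>') \<in> z"
    using mem s by (simp_all add: additive_subgroup.a_closed)
  ultimately show "(p \<oplus> p', q \<oplus> q') \<in> middle_relation G x a b z"
    using p by (intro middle_relationI[of "\<alpha> \<oplus> \<alpha>'" _ _ _ "\<beta> \<oplus> \<beta>'"]) simp_all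
  have "q \<ominus> q' = (\<alpha> \<ominus> \<alpha>') \<oplus> (p \<ominus> p') \<oplus> (\<beta> \<ominus> \<beta>')"
    "(\<alpha> \<ominus> \<alpha>') \<oplus> (p \<ominus> p') = (\<alpha> \<oplus> p) \<ominus> (\<alpha>' \<oplus> p')"
    "(p \<ominus> p') \<oplus> (\<beta> \<ominus> \<beta>') = (p \<oplus> \<beta>) \<ominus> (p' \<oplus> \<beta>')"
    unfolding eq using c p by (simp_all add: a_minus_def minus_add a_ac)
  moreover have "\<alpha> \<ominus> \<alpha>' \<in> a" "\<beta> \<ominus> \<beta>' \<in> b" "(\<alpha> \<oplus> p) \<ominus> (\<alpha>' \<oplus> p') \<in> x"
    "(p \<oplus> \<beta>) \<ominus> (p' \<oplus> \<beta>') \<in> z"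
    using mem s by (simp_all add: additive_subgroup_minus_closed)
  ultimately show "(p \<ominus> p', q \<ominus> q') \<in> middle_relation G x a b z"
    using p by (intro middle_relationI[of "\<alpha> \<ominus> \<alpha>'" _ _ _ "\<beta> \<ominus> \<beta>'"]) simp_all
qed

text \<open>An additive relation containing the zero pair maps subgroups to subgroups, and
  \<open>Gam\<close> is the image of \<open>z\<close> under \<open>left_relation\<close>.\<close>

lemma additive_subgroup_Gam:
  assumes s: "additive_subgroup x G" "additive_subgroup a G" "additive_subgroup y G"
    "additive_subgroup b G" "additive_subgroup z G"
  shows "additive_subgroup (Gam G x a y b z) G"
proof -
  let ?r = "left_relation G x a y b"
  note sub = s[THEN additive_subgroup.a_subset]
  note Gam = Gam_eq_left_relation_Image[OF sub]
  note r = additive_relation_left_relation[OF s(1-4)]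
  have zero: "\<zero> \<in> x" "\<zero> \<in> a" "\<zero> \<in> y" "\<zero> \<in> b" "\<zero> \<in> z"
    using s by (simp_all add: additive_subgroup.zero_closed)
  \<comment> \<open>\<open>additive_relation\<close> admits the empty relation, so the zero pair is
    supplied by taking all three parameters zero.\<close>
  have "(\<zero>, \<zero>) \<in> ?r"
    unfolding left_relation_def using zero by (auto intro!: exI[of _ \<zero>])
  have sub': "?r `` z \<subseteq> carrier G"
    using r by (auto simp: additive_relation_def)
  have "\<zero> \<in> ?r `` z"
    using zero \<open>(\<zero>, \<zero>) \<in> ?r\<close> by blast
  moreover have "p \<oplus> q \<in> ?r `` z" if "p \<in> ?r `` z" "q \<in> ?r `` z" for p q
    using that r s(5) unfolding additive_relation_def
    by (blast intro: additive_subgroup.a_closed)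
  moreover have "\<ominus> q \<in> ?r `` z" if q: "q \<in> ?r `` z" for q
  proof -
    obtain p where p: "p \<in> z" "(p, q) \<in> ?r"
      using q by blast
    \<comment> \<open>Negation is obtained as a difference from the zero pair.\<close>
    then have "(\<zero> \<ominus> p, \<zero> \<ominus> q) \<in> ?r"
      using r \<open>(\<zero>, \<zero>) \<in> ?r\<close> unfolding additive_relation_def by blast
    moreover have "\<zero> \<ominus> p \<in> z"
      using additive_subgroup_minus_closed[OF s(5)] zero p by blast
    moreover have "\<zero> \<ominus> q = \<ominus> q"
      using q sub' by (auto simp: a_minus_def)
    ultimately show ?thesis
      by auto
  qed
  ultimately have "subgroup (?r `` z) (add_monoid G)"
    using sub' by (intro add.subgroupI) (auto simp: a_inv_def[symmetric])
  then show ?thesis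
    unfolding Gam by (rule additive_subgroupI)
qed

end

section \<open>Submodules and the three structural pairs\<close>

lemma submodule_iff_additive_subgroup:
  "submodule H R M \<longleftrightarrow> additive_subgroup H M \<and> (\<forall>c\<in>carrier R. \<forall>h\<in>H. c \<odot>\<^bsub>M\<^esub> h \<in> H)"
  by (auto simp: submodule_def submodule_axioms_def additive_subgroup_def)

context right_module
begin

lemma additive_subgroup_if_submodules:
  "x \<in> submodules B W \<Longrightarrow> additive_subgroup x W"
  by (simp add: submodules_def submodule_iff_additive_subgroup)

lemma submodules_subset_carrier:
  "x \<in> submodules B W \<Longrightarrow> x \<subseteq> carrier W"
  by (rule additive_subgroup.a_subset[OF additive_subgroup_if_submodules])

text \<open>The additive half is \<open>additive_subgroup_Gam\<close>. For scalars, \<open>c\<close>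
  acts on \<alpha>, \<eta>, \<beta> separately, and distributivity carries this to the total and to
  both partial sums.\<close>

lemma Gam_in_submodules:
  assumes s: "x \<in> submodules B W" "a \<in> submodules B W" "y \<in> submodules B W"
    "b \<in> submodules B W" "z \<in> submodules B W"
  shows "Gam W x a y b z \<in> submodules B W"
proof -
  note Gam = Gam_eq[OF s[THEN submodules_subset_carrier]]
  have "c \<odot>\<^bsub>W\<^esub> \<omega> \<in> Gam W x a y b z" if c: "c \<in> carrier B" and \<omega>: "\<omega> \<in> Gam W x a y b z" for c \<omega>
  proof -
    obtain \<alpha> \<eta> \<beta> where mem: "\<alpha> \<in> a" "\<eta> \<in> y" "\<beta> \<in> b" "\<alpha> \<oplus>\<^bsub>W\<^esub> \<eta> \<in> x" "\<eta> \<oplus>\<^bsub>W\<^esub> \<beta> \<in> z"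
      and eq: "\<omega> = \<alpha> \<oplus>\<^bsub>W\<^esub> \<eta> \<oplus>\<^bsub>W\<^esub> \<beta>"
      using \<omega> unfolding Gam by blast
    have car: "\<alpha> \<in> carrier W" "\<eta> \<in> carrier W" "\<beta> \<in> carrier W"
      using mem s submodules_subset_carrier by blast+
    have "c \<odot>\<^bsub>W\<^esub> \<alpha> \<in> a" "c \<odot>\<^bsub>W\<^esub> \<eta> \<in> y" "c \<odot>\<^bsub>W\<^esub> \<beta> \<in> b"
      "c \<odot>\<^bsub>W\<^esub> (\<alpha> \<oplus>\<^bsub>W\<^esub> \<eta>) \<in> x" "c \<odot>\<^bsub>W\<^esub> (\<eta> \<oplus>\<^bsub>W\<^esub> \<beta>) \<in> z"
      using mem s c by (simp_all add: submodules_def submodule_iff_additive_subgroup)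
    then show ?thesis
      unfolding Gam eq using c car by (auto simp: ract_add_vector)
  qed
  then show ?thesis
    using additive_subgroup_Gam[OF s[THEN additive_subgroup_if_submodules]]
    by (simp add: submodules_def submodule_iff_additive_subgroup)
qed

lemma structural_pair_Lop:
  assumes s: "x \<in> submodules B W" "a \<in> submodules B W" "y \<in> submodules B W" "b \<in> submodules B W"
  shows "structural_pair (submodules B W) (Gam W) (Lop W x a y b) (Lop W y a x b)"
proof (rule structural_pair_Image)
  note add = s[THEN additive_subgroup_if_submodules]
  show "additive_relation W (left_relation W x a y b)"
    by (rule additive_relation_left_relation[OF add])
  show "Lop W x a y b S = left_relation W x a y b `` S"
    and "Lop W y a x b S = (left_relation W x a y b)\<inverse> `` S" if "S \<in> submodules B W" for S
    using s that
    by (simp_all add: Lop_def left_relation_converse[OF add] Gam_eq_left_relation_Image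
        submodules_subset_carrier)
\<comment> \<open>What remains is that submodules lie in the carrier and that \<open>Gam\<close> and
  both operators preserve them.\<close>
qed (use s in \<open>simp_all add: Lop_def Gam_in_submodules submodules_subset_carrier\<close>)

lemma structural_pair_Mop:
  assumes s: "x \<in> submodules B W" "a \<in> submodules B W" "b \<in> submodules B W" "z \<in> submodules B W"
  shows "structural_pair (submodules B W) (Gam W) (Mop W x a b z) (Mop W z a b x)"
proof (rule structural_pair_Image)
  note add = s[THEN additive_subgroup_if_submodules]
  show "additive_relation W (middle_relation W x a b z)"
    by (rule additive_relation_middle_relation[OF add])
  show "Mop W x a b z S = middle_relation W x a b z `` S"
    and "Mop W z a b x S = (middle_relation W x a b z)\<inverse> `` S" if "S \<in> submodules B W" for S
    using s that
    by (simp_all add: Mop_def middle_relation_converse[OF add] Gam_eq_middle_relation_Image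
        submodules_subset_carrier)
qed (use s in \<open>simp_all add: Mop_def Gam_in_submodules submodules_subset_carrier\<close>)

text \<open>By \<open>Gam_reverse\<close>, the operators with indices \<open>a y b z\<close> and
  \<open>a z b y\<close> are left multiplications with indices \<open>z b y a\<close> and
  \<open>y b z a\<close>, whose relations are converse to each other.\<close>

lemma structural_pair_Rop:
  assumes s: "a \<in> submodules B W" "y \<in> submodules B W" "b \<in> submodules B W" "z \<in> submodules B W"
  shows "structural_pair (submodules B W) (Gam W) (Rop W a y b z) (Rop W a z b y)"
proof (rule structural_pair_Image)
  note add = s[THEN additive_subgroup_if_submodules]
  show "additive_relation W (left_relation W z b y a)"
    by (rule additive_relation_left_relation[OF add(4,3,2,1)])
  show "Rop W a y b z S = left_relation W z b y a `` S"
    and "Rop W a z b y S = (left_relation W z b y a)\<inverse> `` S" if "S \<in> submodules B W" for S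
    using s that Gam_reverse[of S a y b z] Gam_reverse[of S a z b y]
      Gam_eq_left_relation_Image[of z b y a S] Gam_eq_left_relation_Image[of y b z a S]
    by (simp_all add: Rop_def left_relation_converse[OF add(4,3,2,1)] submodules_subset_carrier)
qed (use s in \<open>simp_all add: Rop_def Gam_in_submodules submodules_subset_carrier\<close>)

end

theorem theorem2p7:
  fixes K :: "('k, 'l) ring_scheme"
    and B :: "('k, 'b, 'm) module_scheme"
    and W :: "('b, 'w, 'n) module_scheme"
  assumes "cring K"
    and "assoc_algebra K B"
    and "right_module B W"
    and "x \<in> submodules B W" and "a \<in> submodules B W" and "y \<in> submodules B W"
    and "b \<in> submodules B W" and "z \<in> submodules B W"
  shows "structural_pair (submodules B W) (Gam W) (Lop W x a y b) (Lop W y a x b)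
    \<and> structural_pair (submodules B W) (Gam W) (Mop W x a b z) (Mop W z a b x)
    \<and> structural_pair (submodules B W) (Gam W) (Rop W a y b z) (Rop W a z b y)"
  using assms by (intro conjI right_module.structural_pair_Lop right_module.structural_pair_Mop
    right_module.structural_pair_Rop)

end
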